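(* Let $X$ be a Tychonoff space and let $E$ be any set of functions with $L(X)\subseteq E\subseteq C(X_{\aleph_0})$, endowed with the topology of pointwise convergence. Then $l(E)\ge t^*(X_{\aleph_0})$.
   Context: All spaces are Tychonoff. A zero-set of $X$ is a set $\{x\in X: f(x)=0\}$ with $f:X\to\mathbb{R}$ continuous; $Z(X)$ is the family of all zero-sets of $X$. $X_{\aleph_0}$ is the set $X$ with the (Baire) topology having $Z(X)$ as a base. $C(X_{\aleph_0})$ is the set of all continuous real-valued functions on $X_{\aleph_0}$. $L(X)=\{n_1 f_{Z_1}+\dots+n_k f_{Z_k}: k\in\mathbb{N},\ n_i\in\mathbb{N},\ Z_i\in Z(X)\}$, where $f_Z$ is the characteristic function of $Z\subseteq X$. The topology of pointwise convergence on $E$ is the subspace topology from $\mathbb{R}^X$. $l(Y)$ is the Lindelöf number of $Y$, $t(Y)$ is the tightness of $Y$, and $t^*(Y)=\sup\{t(Y^n): n\in\mathbb{N}\}$. As is standard, values of cardinal functions are taken to be infinite cardinals (at least $\omega_0$). *)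

theory Defs
  imports "HOL-Analysis.Analysis"
begin

unbundle cardinal_syntax

text \<open>
  Spaces are abstract topologies on a carrier \<open>topspace X\<close>, and a function on the space is
  represented by the HOL function that is \<open>undefined\<close> off the carrier (\<open>extensional\<close>), so that sets
  of functions on the space are subsets of the product over \<open>topspace X\<close>.
\<close>

definition tychonoff_space :: "'a topology \<Rightarrow> bool" where
  "tychonoff_space X \<longleftrightarrow> completely_regular_space X \<and> t1_space X"


section \<open>Zero-sets and the Baire topology\<close>

definition zero_sets :: "'a topology \<Rightarrow> 'a set set" where
  "zero_sets X = {{x \<in> topspace X. f x = 0} | f. continuous_map X euclideanreal f}"

definition baire_topology :: "'a topology \<Rightarrow> 'a topology" where
  "baire_topology X = topology (arbitrary union_of (\<lambda>Z. Z \<in> zero_sets X))"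

lemma zero_sets_Int:
  assumes "S \<in> zero_sets X" "T \<in> zero_sets X"
  shows "S \<inter> T \<in> zero_sets X"
proof -
  obtain f g where f: "continuous_map X euclideanreal f" "S = {x \<in> topspace X. f x = 0}"
    and g: "continuous_map X euclideanreal g" "T = {x \<in> topspace X. g x = 0}"
    using assms by (auto simp: zero_sets_def)
  have "continuous_map X euclideanreal (\<lambda>x. \<bar>f x\<bar> + \<bar>g x\<bar>)"
    using f g by (intro continuous_intros) auto
  moreover have "S \<inter> T = {x \<in> topspace X. \<bar>f x\<bar> + \<bar>g x\<bar> = 0}"
    using f g by auto
  ultimately show ?thesis
    by (auto simp: zero_sets_def)
qed

lemma openin_baire_topology:
  "openin (baire_topology X) = arbitrary union_of (\<lambda>Z. Z \<in> zero_sets X)"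
  unfolding baire_topology_def
  by (intro topology_inverse' istopology_base zero_sets_Int)

lemma topspace_baire_topology [simp]: "topspace (baire_topology X) = topspace X"
proof -
  have *: "topspace X \<in> zero_sets X"
    by (auto simp: zero_sets_def intro!: exI[of _ "\<lambda>x. 0"])
  then have "openin (baire_topology X) (topspace X)"
    by (simp add: openin_baire_topology arbitrary_union_of_inc)
  moreover have "U \<subseteq> topspace X" if "openin (baire_topology X) U" for U
    using that by (auto simp: openin_baire_topology arbitrary_union_of_alt zero_sets_def)
  ultimately show ?thesis
    by (simp add: openin_subset subset_antisym)
qed


section \<open>Function spaces\<close>

definition continuous_functions :: "'a topology \<Rightarrow> ('a \<Rightarrow> real) set" where
  "continuous_functions Y = {f \<in> extensional (topspace Y). continuous_map Y euclideanreal f}"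

text \<open>
  Whether \<open>0\<close> counts as a natural number is immaterial here: the empty set is a zero-set and its
  characteristic function is \<open>0\<close>.
\<close>

definition zero_set_combinations :: "'a topology \<Rightarrow> ('a \<Rightarrow> real) set" where
  "zero_set_combinations X =
     {(\<lambda>x\<in>topspace X. \<Sum>i<k. real (n i) * indicator (Z i) x) | (k::nat) (n :: nat \<Rightarrow> nat) Z.
        \<forall>i<k. Z i \<in> zero_sets X}"

definition pointwise_topology :: "'a topology \<Rightarrow> ('a \<Rightarrow> real) set \<Rightarrow> ('a \<Rightarrow> real) topology" where
  "pointwise_topology X E = subtopology (product_topology (\<lambda>_. euclideanreal) (topspace X)) E"


section \<open>Cardinal functions\<close>

text \<open>
  A cardinal is a relation satisfying \<open>Card_order\<close>, compared across types by \<open>\<le>o\<close>. The least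
  cardinal with property \<open>P\<close> is only determined up to \<open>=o\<close>, and the definition is meaningful only if
  some cardinal on the type \<open>'c\<close> satisfies \<open>P\<close>.
\<close>

definition least_cardinal :: "('c rel \<Rightarrow> bool) \<Rightarrow> 'c rel" where
  "least_cardinal P =
     (SOME \<kappa>. Card_order \<kappa> \<and> P \<kappa> \<and> (\<forall>\<kappa>'. Card_order \<kappa>' \<and> P \<kappa>' \<longrightarrow> \<kappa> \<le>o \<kappa>'))"

definition lindelof_upto :: "'a topology \<Rightarrow> 'c rel \<Rightarrow> bool" where
  "lindelof_upto Y \<kappa> \<longleftrightarrow>
     (\<forall>\<U>. (\<forall>U\<in>\<U>. openin Y U) \<and> \<Union>\<U> = topspace Y \<longrightarrow>
          (\<exists>\<V>\<subseteq>\<U>. |\<V>| \<le>o \<kappa> \<and> \<Union>\<V> = topspace Y))"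

definition tightness_upto :: "'a topology \<Rightarrow> 'c rel \<Rightarrow> bool" where
  "tightness_upto Y \<kappa> \<longleftrightarrow>
     (\<forall>A x. A \<subseteq> topspace Y \<and> x \<in> Y closure_of A \<longrightarrow>
          (\<exists>B\<subseteq>A. |B| \<le>o \<kappa> \<and> x \<in> Y closure_of B))"

text \<open>
  Both numbers are bounded by the larger of \<open>\<aleph>\<^sub>0\<close> and the cardinality of the space, so a
  representative exists on \<open>nat + 'a\<close>. The lemmas \<open>lindelof_number_le_iff\<close>, \<open>tightness_le_iff\<close> and
  \<open>tightness_star_le_iff\<close> below confirm that this choice of type does not matter.
\<close>

definition lindelof_number :: "'a topology \<Rightarrow> (nat + 'a) rel" where
  "lindelof_number Y = least_cardinal (\<lambda>\<kappa>. cinfinite \<kappa> \<and> lindelof_upto Y \<kappa>)"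

definition tightness :: "'a topology \<Rightarrow> (nat + 'a) rel" where
  "tightness Y = least_cardinal (\<lambda>\<kappa>. cinfinite \<kappa> \<and> tightness_upto Y \<kappa>)"

definition power_topology :: "'a topology \<Rightarrow> nat \<Rightarrow> (nat \<Rightarrow> 'a) topology" where
  "power_topology Y n = product_topology (\<lambda>_. Y) {..<n}"

definition cardinal_sup :: "'c rel set \<Rightarrow> 'c rel" where
  "cardinal_sup R = least_cardinal (\<lambda>\<kappa>. \<forall>\<rho>\<in>R. \<rho> \<le>o \<kappa>)"

definition tightness_star :: "'a topology \<Rightarrow> (nat + (nat \<Rightarrow> 'a)) rel" where
  "tightness_star Y = cardinal_sup {tightness (power_topology Y n) | n. n \<ge> 1}"


subsection \<open>Well-definedness\<close>

lemma least_cardinal: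
  fixes P :: "'c rel \<Rightarrow> bool"
  assumes "Card_order \<kappa>0" "P \<kappa>0"
  shows "Card_order (least_cardinal P)" "P (least_cardinal P)"
    "\<And>\<kappa>'. \<lbrakk>Card_order \<kappa>'; P \<kappa>'\<rbrakk> \<Longrightarrow> least_cardinal P \<le>o \<kappa>'"
proof -
  have "\<exists>\<kappa>\<in>{\<kappa>. Card_order \<kappa> \<and> P \<kappa>}. \<forall>\<kappa>'\<in>{\<kappa>. Card_order \<kappa> \<and> P \<kappa>}. \<kappa> \<le>o \<kappa>'"
    by (rule exists_minim_Card_order) (use assms in auto)
  then have "\<exists>\<kappa>. Card_order \<kappa> \<and> P \<kappa> \<and> (\<forall>\<kappa>'. Card_order \<kappa>' \<and> P \<kappa>' \<longrightarrow> \<kappa> \<le>o \<kappa>')"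
    by auto
  from someI_ex[OF this]
  show "Card_order (least_cardinal P)" "P (least_cardinal P)"
    "\<And>\<kappa>'. \<lbrakk>Card_order \<kappa>'; P \<kappa>'\<rbrakk> \<Longrightarrow> least_cardinal P \<le>o \<kappa>'"
    unfolding least_cardinal_def by blast+
qed

lemma least_cardinal_le_iff:
  fixes P :: "'c rel \<Rightarrow> bool" and Q :: "'d rel \<Rightarrow> bool" and \<kappa> :: "'d rel"
  assumes 0: "Card_order \<kappa>0" "P \<kappa>0"
    and \<kappa>: "Card_order \<kappa>"
    and up: "\<And>\<rho>. \<lbrakk>P \<rho>; \<rho> \<le>o \<kappa>\<rbrakk> \<Longrightarrow> Q \<kappa>"
    and down: "\<And>\<rho>. \<lbrakk>Q \<kappa>; \<kappa> \<le>o \<rho>\<rbrakk> \<Longrightarrow> P \<rho>"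
  shows "least_cardinal P \<le>o \<kappa> \<longleftrightarrow> Q \<kappa>"
proof
  assume "least_cardinal P \<le>o \<kappa>"
  then show "Q \<kappa>"
    using up[OF least_cardinal(2)[of \<kappa>0 P, OF 0]] by simp
next
  assume Q: "Q \<kappa>"
  note L = least_cardinal[of \<kappa>0 P, OF 0]
  have "\<kappa> \<le>o least_cardinal P \<Longrightarrow> least_cardinal P \<le>o \<kappa>"
  proof -
    assume "\<kappa> \<le>o least_cardinal P"
    then obtain p :: "'c rel" where p: "\<kappa> =o p"
      unfolding internalize_ordLeq[of \<kappa>] by blast
    have "Card_order p"
      using Card_order_ordIso2[OF \<kappa> p] .
    moreover have "P p"
      using down[OF Q] p unfolding ordIso_iff_ordLeq by simp
    ultimately have "least_cardinal P \<le>o p"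
      by (rule L(3))
    then show "least_cardinal P \<le>o \<kappa>"
      using ordLeq_ordIso_trans ordIso_symmetric[OF p] by blast
  qed
  moreover have "least_cardinal P \<le>o \<kappa> \<or> \<kappa> \<le>o least_cardinal P"
    using L(1) \<kappa> by (intro ordLeq_total) (simp_all add: card_order_on_def)
  ultimately show "least_cardinal P \<le>o \<kappa>"
    by blast
qed

lemma card_of_le_Plus_UNIV: "|A :: 'a set| \<le>o |UNIV :: (nat + 'a) set|"
  by (rule card_of_ordLeqI[where f = Inr]) auto

lemma Cinfinite_Plus_UNIV: "Cinfinite |UNIV :: (nat + 'a) set|"
  by (intro conjI card_of_Card_order) (simp add: cinfinite_def Field_card_of)

lemma lindelof_upto_mono: "\<lbrakk>lindelof_upto Y \<kappa>; \<kappa> \<le>o \<rho>\<rbrakk> \<Longrightarrow> lindelof_upto Y \<rho>"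
  unfolding lindelof_upto_def by (meson ordLeq_transitive)

lemma tightness_upto_mono: "\<lbrakk>tightness_upto Y \<kappa>; \<kappa> \<le>o \<rho>\<rbrakk> \<Longrightarrow> tightness_upto Y \<rho>"
  unfolding tightness_upto_def by (meson ordLeq_transitive)

lemma lindelof_upto_UNIV: "lindelof_upto (Y :: 'a topology) |UNIV :: (nat + 'a) set|"
  unfolding lindelof_upto_def
proof (intro allI impI)
  fix \<U> assume \<U>: "(\<forall>U\<in>\<U>. openin Y U) \<and> \<Union>\<U> = topspace Y"
  then have "\<forall>x\<in>topspace Y. \<exists>U\<in>\<U>. x \<in> U"
    by auto
  then obtain g where g: "\<And>x. x \<in> topspace Y \<Longrightarrow> g x \<in> \<U> \<and> x \<in> g x"
    by metis
  have "|g ` topspace Y| \<le>o |UNIV :: (nat + 'a) set|"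
    by (rule ordLeq_transitive[OF card_of_image card_of_le_Plus_UNIV])
  moreover have "g ` topspace Y \<subseteq> \<U>" "\<Union>(g ` topspace Y) = topspace Y"
    using g \<U> by blast+
  ultimately show "\<exists>\<V>\<subseteq>\<U>. |\<V>| \<le>o |UNIV :: (nat + 'a) set| \<and> \<Union>\<V> = topspace Y"
    by blast
qed

lemma tightness_upto_UNIV: "tightness_upto (Y :: 'a topology) |UNIV :: (nat + 'a) set|"
  unfolding tightness_upto_def
proof (intro allI impI)
  fix A x assume "A \<subseteq> topspace Y \<and> x \<in> Y closure_of A"
  then show "\<exists>B\<subseteq>A. |B| \<le>o |UNIV :: (nat + 'a) set| \<and> x \<in> Y closure_of B"
    by (intro exI[of _ A]) (simp add: card_of_le_Plus_UNIV)
qed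

lemma
  fixes Y :: "'a topology"
  shows Cinfinite_lindelof_number: "Cinfinite (lindelof_number Y)"
    and lindelof_upto_lindelof_number: "lindelof_upto Y (lindelof_number Y)"
proof -
  let ?P = "\<lambda>\<kappa> :: (nat + 'a) rel. cinfinite \<kappa> \<and> lindelof_upto Y \<kappa>"
  have "Card_order |UNIV :: (nat + 'a) set|" "?P |UNIV|"
    by (simp_all add: Cinfinite_Plus_UNIV lindelof_upto_UNIV)
  from least_cardinal(1,2)[of _ ?P, OF this]
  show "Cinfinite (lindelof_number Y)" "lindelof_upto Y (lindelof_number Y)"
    by (simp_all add: lindelof_number_def)
qed

lemma
  fixes Y :: "'a topology"
  shows Cinfinite_tightness: "Cinfinite (tightness Y)"
    and tightness_upto_tightness: "tightness_upto Y (tightness Y)"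
proof -
  let ?P = "\<lambda>\<kappa> :: (nat + 'a) rel. cinfinite \<kappa> \<and> tightness_upto Y \<kappa>"
  have "Card_order |UNIV :: (nat + 'a) set|" "?P |UNIV|"
    by (simp_all add: Cinfinite_Plus_UNIV tightness_upto_UNIV)
  from least_cardinal(1,2)[of _ ?P, OF this]
  show "Cinfinite (tightness Y)" "tightness_upto Y (tightness Y)"
    by (simp_all add: tightness_def)
qed

theorem lindelof_number_le_iff:
  fixes Y :: "'a topology"
  assumes "Cinfinite \<kappa>"
  shows "lindelof_number Y \<le>o \<kappa> \<longleftrightarrow> lindelof_upto Y \<kappa>"
  unfolding lindelof_number_def
proof (rule least_cardinal_le_iff[where Q = "lindelof_upto Y"])
  show "Card_order |UNIV :: (nat + 'a) set|"
    by (rule card_of_Card_order)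
  show "cinfinite |UNIV :: (nat + 'a) set| \<and> lindelof_upto Y |UNIV :: (nat + 'a) set|"
    using Cinfinite_Plus_UNIV lindelof_upto_UNIV by blast
  show "Card_order \<kappa>"
    using assms ..
  show "lindelof_upto Y \<kappa>"
    if "cinfinite \<rho> \<and> lindelof_upto Y \<rho>" "\<rho> \<le>o \<kappa>" for \<rho> :: "(nat + 'a) rel"
    using that lindelof_upto_mono by blast
  show "cinfinite \<rho> \<and> lindelof_upto Y \<rho>"
    if "lindelof_upto Y \<kappa>" "\<kappa> \<le>o \<rho>" for \<rho> :: "(nat + 'a) rel"
    using that assms lindelof_upto_mono cinfinite_mono by blast
qed

theorem tightness_le_iff:
  fixes Y :: "'a topology"
  assumes "Cinfinite \<kappa>"
  shows "tightness Y \<le>o \<kappa> \<longleftrightarrow> tightness_upto Y \<kappa>"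
  unfolding tightness_def
proof (rule least_cardinal_le_iff[where Q = "tightness_upto Y"])
  show "Card_order |UNIV :: (nat + 'a) set|"
    by (rule card_of_Card_order)
  show "cinfinite |UNIV :: (nat + 'a) set| \<and> tightness_upto Y |UNIV :: (nat + 'a) set|"
    using Cinfinite_Plus_UNIV tightness_upto_UNIV by blast
  show "Card_order \<kappa>"
    using assms ..
  show "tightness_upto Y \<kappa>"
    if "cinfinite \<rho> \<and> tightness_upto Y \<rho>" "\<rho> \<le>o \<kappa>" for \<rho> :: "(nat + 'a) rel"
    using that tightness_upto_mono by blast
  show "cinfinite \<rho> \<and> tightness_upto Y \<rho>"
    if "tightness_upto Y \<kappa>" "\<kappa> \<le>o \<rho>" for \<rho> :: "(nat + 'a) rel"
    using that assms tightness_upto_mono cinfinite_mono by blast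
qed

theorem tightness_star_le_iff:
  fixes Y :: "'a topology"
  assumes "Card_order \<kappa>"
  shows "tightness_star Y \<le>o \<kappa> \<longleftrightarrow> (\<forall>n\<ge>1. tightness (power_topology Y n) \<le>o \<kappa>)"
  unfolding tightness_star_def cardinal_sup_def
proof (rule least_cardinal_le_iff
    [where Q = "\<lambda>\<kappa>. \<forall>n\<ge>1. tightness (power_topology Y n) \<le>o \<kappa>"])
  show "Card_order |UNIV :: (nat + (nat \<Rightarrow> 'a)) set|"
    by (rule card_of_Card_order)
  have "tightness (power_topology Y n) \<le>o |UNIV :: (nat + (nat \<Rightarrow> 'a)) set|" for n
    using tightness_le_iff[OF Cinfinite_Plus_UNIV] tightness_upto_UNIV by blast
  then show "\<forall>\<rho>\<in>{tightness (power_topology Y n) | n. n \<ge> 1}.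
      \<rho> \<le>o |UNIV :: (nat + (nat \<Rightarrow> 'a)) set|"
    by blast
  show "\<forall>n\<ge>1. tightness (power_topology Y n) \<le>o \<kappa>"
    if "\<forall>\<rho>\<in>{tightness (power_topology Y n) | n. n \<ge> 1}. \<rho> \<le>o \<sigma>" "\<sigma> \<le>o \<kappa>"
    for \<sigma> :: "(nat + (nat \<Rightarrow> 'a)) rel"
    using that ordLeq_transitive by blast
  show "\<forall>\<rho>\<in>{tightness (power_topology Y n) | n. n \<ge> 1}. \<rho> \<le>o \<sigma>"
    if "\<forall>n\<ge>1. tightness (power_topology Y n) \<le>o \<kappa>" "\<kappa> \<le>o \<sigma>"
    for \<sigma> :: "(nat + (nat \<Rightarrow> 'a)) rel"
    using that ordLeq_transitive by blast
qed (use assms in blast)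

lemma Lindelof_space_iff_lindelof_number:
  "Lindelof_space Y \<longleftrightarrow> lindelof_number Y \<le>o natLeq"
proof -
  have "countable \<V> \<longleftrightarrow> |\<V>| \<le>o natLeq" for \<V> :: "'a set set"
    unfolding countable_def card_of_ordLeq[symmetric]
    by (metis card_of_nat card_of_ordLeq ordIso_symmetric ordLeq_ordIso_trans subset_UNIV)
  then show ?thesis
    unfolding lindelof_number_le_iff[OF natLeq_Cinfinite] Lindelof_space_def lindelof_upto_def
    by meson
qed

end

theory Submission
  imports Defs
begin

text \<open>
  The inequality is the Asanov argument for \<open>C\<^sub>p\<close>-theory, which only uses the following weak
  Urysohn property of a set \<open>E\<close> of continuous functions on a Hausdorff space \<open>Y\<close>: for every finite
  \<open>P\<close> inside an open \<open>U\<close>, some member of \<open>E\<close> is at least \<open>1\<close> on \<open>P\<close> and at most \<open>0\<close> off \<open>U\<close>.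

  Let \<open>x\<close> lie in the closure of \<open>A\<close> in \<open>Y\<^sup>n\<close>. The functions \<open>f\<close> in \<open>E\<close> with \<open>f (x i) \<ge> 1\<close> for all
  \<open>i\<close> form a closed set \<open>F\<close>. For such an \<open>f\<close> the set \<open>{f > 0}\<close> is a neighbourhood of every \<open>x i\<close>,
  so some \<open>a\<close> in \<open>A\<close> has all its coordinates in it. Thus the open sets
  \<open>{f. \<forall>i<n. f (a i) > 0}\<close> with \<open>a\<close> in \<open>A\<close> cover \<open>F\<close>, and if \<open>E\<close> has Lindelof number at most
  \<open>\<kappa>\<close>, then those with \<open>a\<close> in some \<open>B\<close> of size at most \<open>\<kappa>\<close> already do. Applied to functions of
  \<open>F\<close> that are at most \<open>0\<close> off \<open>V 0 \<union> \<dots> \<union> V (n - 1)\<close>, for neighbourhoods \<open>V i\<close> of \<open>x i\<close>, this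
  gives points of \<open>B\<close> with all coordinates in that union; when the neighbourhoods of distinct
  coordinates are disjoint and \<open>A\<close> has been cut down accordingly, each coordinate must lie in the
  correct \<open>V i\<close>, so \<open>x\<close> is in the closure of \<open>B\<close>. This is \<open>tightness_power_if_lindelof\<close>.

  In the Baire topology zero-sets are open, so distinct points of a Tychonoff space are separated by
  disjoint level sets of one continuous function, and a finite sum of characteristic functions of
  zero-sets provides the required member of \<open>E\<close>.
\<close>

section \<open>Tightness of finite powers and Lindelof function spaces\<close>

lemma Hausdorff_separate_finite:
  assumes "Hausdorff_space Y" "finite P" "P \<subseteq> topspace Y"
  obtains U where "\<And>p. p \<in> P \<Longrightarrow> openin Y (U p)" "\<And>p. p \<in> P \<Longrightarrow> p \<in> U p"
    "\<And>p q. \<lbrakk>p \<in> P; q \<in> P; p \<noteq> q\<rbrakk> \<Longrightarrow> disjnt (U p) (U q)"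
proof -
  have "\<exists>S T. p \<in> P \<and> q \<in> P \<and> p \<noteq> q \<longrightarrow>
      openin Y S \<and> openin Y T \<and> p \<in> S \<and> q \<in> T \<and> disjnt S T" for p q
    using assms(1,3) unfolding Hausdorff_space_def by (metis subsetD)
  then obtain S T where ST: "\<And>p q. \<lbrakk>p \<in> P; q \<in> P; p \<noteq> q\<rbrakk> \<Longrightarrow>
      openin Y (S p q) \<and> openin Y (T p q) \<and> p \<in> S p q \<and> q \<in> T p q \<and> disjnt (S p q) (T p q)"
    by metis
  \<comment> \<open>The separating pair depends on the order of the two points, so both orders are intersected.\<close>
  define U where "U p = (\<Inter>q\<in>P - {p}. S p q \<inter> T q p) \<inter> topspace Y" for p
  show thesis
  proof
    show "openin Y (U p)" if "p \<in> P" for p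
      unfolding U_def
    proof (rule openin_INT)
      show "openin Y (S p q \<inter> T q p)" if "q \<in> P - {p}" for q
        using that \<open>p \<in> P\<close> ST[of p q] ST[of q p] by (intro openin_Int) auto
    qed (use assms(2) in simp)
    show "p \<in> U p" if "p \<in> P" for p
      unfolding U_def using that ST assms(3) by blast
    show "disjnt (U p) (U q)" if "p \<in> P" "q \<in> P" "p \<noteq> q" for p q
    proof -
      have "U p \<subseteq> S p q" "U q \<subseteq> T p q"
        unfolding U_def using that by blast+
      then show ?thesis
        using ST[OF that] by (meson disjnt_subset1 disjnt_subset2)
    qed
  qed
qed

lemma topspace_pointwise_topology:
  assumes "E \<subseteq> extensional (topspace Y)"
  shows "topspace (pointwise_topology Y E) = E"
  using assms by (auto simp: pointwise_topology_def PiE_def)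

lemma continuous_map_pointwise_eval:
  assumes "y \<in> topspace Y"
  shows "continuous_map (pointwise_topology Y E) euclideanreal (\<lambda>f. f y)"
  unfolding pointwise_topology_def
  using assms by (intro continuous_map_from_subtopology continuous_map_product_projection)

text \<open>
  Covering a closed set \<open>F\<close> costs no more than covering the whole space: the complement of \<open>F\<close> is
  added to the cover. The subcover is recorded through its indices, because the index set is what
  becomes the small set in the closure argument.
\<close>

lemma lindelof_upto_closed_indexed_cover:
  assumes "lindelof_upto Y \<kappa>" "closedin Y F"
    and op: "\<And>a. a \<in> A \<Longrightarrow> openin Y (W a)" and cover: "F \<subseteq> (\<Union>a\<in>A. W a)"
  obtains B where "B \<subseteq> A" "|B| \<le>o \<kappa>" "F \<subseteq> (\<Union>b\<in>B. W b)"
proof -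
  let ?\<U> = "insert (topspace Y - F) (W ` A)"
  have "(\<forall>U\<in>?\<U>. openin Y U) \<and> \<Union>?\<U> = topspace Y"
  proof (intro conjI ballI)
    show "openin Y U" if "U \<in> ?\<U>" for U
      using that op assms(2) by (auto simp: closedin_def)
    have "W a \<subseteq> topspace Y" if "a \<in> A" for a
      using op[OF that] by (rule openin_subset)
    then have "\<Union>(W ` A) \<subseteq> topspace Y"
      by (rule UN_least)
    then show "\<Union>?\<U> = topspace Y"
      using cover by auto
  qed
  then obtain \<V> where \<V>: "\<V> \<subseteq> ?\<U>" "|\<V>| \<le>o \<kappa>" "\<Union>\<V> = topspace Y"
    using assms(1) unfolding lindelof_upto_def by meson
  define g where "g = inv_into A W"
  have g: "g V \<in> A \<and> W (g V) = V" if "V \<in> W ` A" for V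
    using that by (simp add: g_def inv_into_into f_inv_into_f)
  let ?B = "g ` (\<V> \<inter> W ` A)"
  show thesis
  proof
    show "?B \<subseteq> A"
      using g by blast
    have "|?B| \<le>o |\<V> \<inter> W ` A|"
      by (rule card_of_image)
    also have "|\<V> \<inter> W ` A| \<le>o |\<V>|"
      by (rule card_of_mono1) blast
    finally show "|?B| \<le>o \<kappa>"
      using \<V>(2) ordLeq_transitive by blast
    show "F \<subseteq> (\<Union>b\<in>?B. W b)"
    proof
      fix f assume f: "f \<in> F"
      then have "f \<in> \<Union>\<V>"
        using assms(2) \<V>(3) closedin_subset by blast
      then obtain V where V: "V \<in> \<V>" "f \<in> V"
        by blast
      then have "V \<in> W ` A"
        using f \<V>(1) by blast
      then show "f \<in> (\<Union>b\<in>?B. W b)"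
        using V g by (intro UN_I[of "g V"]) auto
    qed
  qed
qed

text \<open>
  A form of the theorem of Asanov. Coordinates of \<open>x\<close> may coincide, so neighbourhoods are attached
  to the points \<open>x i\<close> rather than to the indices \<open>i\<close>.
\<close>

theorem tightness_power_if_lindelof:
  assumes haus: "Hausdorff_space Y"
    and E: "E \<subseteq> continuous_functions Y"
    and urysohn: "\<And>P U. \<lbrakk>finite P; P \<subseteq> U; openin Y U\<rbrakk> \<Longrightarrow>
        \<exists>f\<in>E. (\<forall>p\<in>P. 1 \<le> f p) \<and> (\<forall>y\<in>topspace Y - U. f y \<le> 0)"
    and lind: "lindelof_upto (pointwise_topology Y E) \<kappa>"
  shows "tightness_upto (power_topology Y n) \<kappa>"
  unfolding tightness_upto_def
proof (intro allI impI)
  fix A x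
  assume "A \<subseteq> topspace (power_topology Y n) \<and> x \<in> power_topology Y n closure_of A"
  then have A: "A \<subseteq> (\<Pi>\<^sub>E i\<in>{..<n}. topspace Y)"
    and x: "x \<in> (\<Pi>\<^sub>E i\<in>{..<n}. topspace Y)"
    and cl: "\<And>T. \<lbrakk>openin (power_topology Y n) T; x \<in> T\<rbrakk> \<Longrightarrow> \<exists>a\<in>A. a \<in> T"
    by (auto simp: power_topology_def in_closure_of)
  have xi: "x i \<in> topspace Y" if "i < n" for i
    using x that by auto
  let ?P = "x ` {..<n}" and ?Cp = "pointwise_topology Y E"
  have "finite ?P" "?P \<subseteq> topspace Y"
    using xi by auto
  with haus obtain U where UP: "\<And>p. p \<in> ?P \<Longrightarrow> openin Y (U p)" "\<And>p. p \<in> ?P \<Longrightarrow> p \<in> U p"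
    "\<And>p q. \<lbrakk>p \<in> ?P; q \<in> ?P; p \<noteq> q\<rbrakk> \<Longrightarrow> disjnt (U p) (U q)"
    by (rule Hausdorff_separate_finite) (rule that)
  have U: "openin Y (U (x i))" "x i \<in> U (x i)" if "i < n" for i
    using UP(1,2) that by simp_all
  have disj: "disjnt (U (x i)) (U (x j))" if "i < n" "j < n" "x i \<noteq> x j" for i j
    using UP(3) that by simp
  have box: "\<exists>a\<in>A. \<forall>i<n. a i \<in> V i"
    if "\<And>i. i < n \<Longrightarrow> openin Y (V i)" "\<And>i. i < n \<Longrightarrow> x i \<in> V i" for V
  proof -
    have "openin (power_topology Y n) (\<Pi>\<^sub>E i\<in>{..<n}. V i)"
      unfolding power_topology_def openin_PiE_gen using that by simp
    moreover have "x \<in> (\<Pi>\<^sub>E i\<in>{..<n}. V i)"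
      using x that(2) by (auto simp: PiE_iff)
    ultimately show ?thesis
      using cl by (metis PiE_mem lessThan_iff)
  qed
  have topE: "topspace ?Cp = E"
    by (rule topspace_pointwise_topology) (use E in \<open>auto simp: continuous_functions_def\<close>)
  define A' where "A' = {a \<in> A. \<forall>i<n. a i \<in> U (x i)}"
  define F where "F = {f \<in> E. \<forall>i<n. 1 \<le> f (x i)}"
  define W where "W a = {f \<in> E. \<forall>i<n. 0 < f (a i)}" for a
  have "closedin ?Cp F"
  proof -
    have "closedin ?Cp {f \<in> topspace ?Cp. f (x i) \<in> {1..}}" if "i < n" for i
      using continuous_map_pointwise_eval[OF xi[OF that]]
      by (rule closedin_continuous_map_preimage) auto
    then have "closedin ?Cp (\<Inter>(insert (topspace ?Cp)
        ((\<lambda>i. {f \<in> topspace ?Cp. f (x i) \<in> {1..}}) ` {..<n})))"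
      by (intro closedin_Inter) auto
    moreover have "F = \<Inter>(insert (topspace ?Cp)
        ((\<lambda>i. {f \<in> topspace ?Cp. f (x i) \<in> {1..}}) ` {..<n}))"
      by (auto simp: F_def topE)
    ultimately show ?thesis
      by simp
  qed
  moreover have "openin ?Cp (W a)" if "a \<in> A'" for a
  proof -
    have ai: "a i \<in> topspace Y" if "i < n" for i
      using \<open>a \<in> A'\<close> A that by (auto simp: A'_def)
    have "openin ?Cp {f \<in> topspace ?Cp. f (a i) \<in> {0<..}}" if "i < n" for i
      using continuous_map_pointwise_eval[OF ai[OF that]]
      by (rule openin_continuous_map_preimage) auto
    then have "openin ?Cp ((\<Inter>i\<in>{..<n}. {f \<in> topspace ?Cp. f (a i) \<in> {0<..}}) \<inter> topspace ?Cp)"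
      by (intro openin_INT) auto
    moreover have "W a = (\<Inter>i\<in>{..<n}. {f \<in> topspace ?Cp. f (a i) \<in> {0<..}}) \<inter> topspace ?Cp"
      by (auto simp: W_def topE)
    ultimately show ?thesis
      by simp
  qed
  moreover have "F \<subseteq> (\<Union>a\<in>A'. W a)"
  proof
    fix f assume f: "f \<in> F"
    then have "continuous_map Y euclideanreal f"
      using E by (auto simp: F_def continuous_functions_def)
    then have pos: "openin Y {y \<in> topspace Y. f y \<in> {0<..}}"
      by (rule openin_continuous_map_preimage) auto
    have "\<exists>a\<in>A. \<forall>i<n. a i \<in> {y \<in> topspace Y. f y \<in> {0<..}} \<inter> U (x i)"
    proof (rule box)
      show "x i \<in> {y \<in> topspace Y. f y \<in> {0<..}} \<inter> U (x i)" if "i < n" for i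
        using that f U xi by (force simp: F_def)
    qed (use pos U in auto)
    then show "f \<in> (\<Union>a\<in>A'. W a)"
      using f by (auto simp: A'_def W_def F_def)
  qed
  ultimately obtain B where B: "B \<subseteq> A'" "|B| \<le>o \<kappa>" "F \<subseteq> (\<Union>b\<in>B. W b)"
    using lindelof_upto_closed_indexed_cover[OF lind] by metis
  have "\<exists>b\<in>B. b \<in> T" if T: "openin (power_topology Y n) T" "x \<in> T" for T
  proof -
    obtain V where "\<forall>i\<in>{..<n}. openin Y (V i)" "x \<in> Pi\<^sub>E {..<n} V"
      and VT: "Pi\<^sub>E {..<n} V \<subseteq> T"
      using T unfolding power_topology_def openin_product_topology_alt by blast
    then have V: "\<And>i. i < n \<Longrightarrow> openin Y (V i)" "\<And>i. i < n \<Longrightarrow> x i \<in> V i"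
      by (auto simp: PiE_iff)
    \<comment> \<open>\<open>V' i\<close> depends only on the point \<open>x i\<close>, which makes it insensitive to repeated coordinates.\<close>
    define V' where "V' i = U (x i) \<inter> (\<Inter>j\<in>{j. j < n \<and> x j = x i}. V j)" for i
    have V'op: "openin Y (V' i)" if "i < n" for i
      unfolding V'_def using that U(1)[OF that] V(1)
      by (intro openin_Int openin_INT2) auto
    have "x i \<in> V j" if "j < n" "x j = x i" for i j
      using V(2)[OF that(1)] that(2) by simp
    then have V'x: "x i \<in> V' i" if "i < n" for i
      unfolding V'_def using U(2)[OF that] by blast
    have "openin Y (\<Union>i<n. V' i)" "?P \<subseteq> (\<Union>i<n. V' i)"
      using V'op V'x by auto
    then obtain f where f: "f \<in> E" "\<And>i. i < n \<Longrightarrow> 1 \<le> f (x i)"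
      and f0: "\<And>y. \<lbrakk>y \<in> topspace Y; y \<notin> (\<Union>i<n. V' i)\<rbrakk> \<Longrightarrow> f y \<le> 0"
      using urysohn[of ?P "\<Union>i<n. V' i"] by auto
    then obtain b where b: "b \<in> B" "f \<in> W b"
      using B(3) by (auto simp: F_def)
    have bU: "b \<in> (\<Pi>\<^sub>E i\<in>{..<n}. topspace Y)" "\<And>i. i < n \<Longrightarrow> b i \<in> U (x i)"
      using b(1) B(1) A by (auto simp: A'_def)
    have "b i \<in> V i" if i: "i < n" for i
    proof -
      have "b i \<in> topspace Y" "0 < f (b i)"
        using i bU(1) b(2) by (auto simp: W_def)
      then obtain j where j: "j < n" "b i \<in> V' j"
        using f0[of "b i"] by force
      then have "x i = x j"
        using disj[OF i j(1)] bU(2)[OF i] by (auto simp: V'_def disjnt_iff)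
      then show ?thesis
        using j i by (auto simp: V'_def)
    qed
    then have "b \<in> (\<Pi>\<^sub>E i\<in>{..<n}. V i)"
      using bU(1) by (auto simp: PiE_iff)
    then show ?thesis
      using VT b(1) by blast
  qed
  then have "x \<in> power_topology Y n closure_of B"
    using x by (auto simp: in_closure_of power_topology_def)
  moreover have "B \<subseteq> A"
    using B(1) by (auto simp: A'_def)
  ultimately show "\<exists>B\<subseteq>A. |B| \<le>o \<kappa> \<and> x \<in> power_topology Y n closure_of B"
    using B(2) by blast
qed

section \<open>The Baire topology\<close>

lemma zero_sets_level_set:
  assumes "continuous_map X euclideanreal f"
  shows "{x \<in> topspace X. f x = c} \<in> zero_sets X"
proof -
  have "continuous_map X euclideanreal (\<lambda>x. f x - c)"
    using assms by (intro continuous_intros) auto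
  then show ?thesis
    unfolding zero_sets_def by (auto intro!: exI[of _ "\<lambda>x. f x - c"])
qed

lemma openin_baire_zero_set: "Z \<in> zero_sets X \<Longrightarrow> openin (baire_topology X) Z"
  by (simp add: openin_baire_topology arbitrary_union_of_inc)

lemma openin_baire_contains_zero_set:
  assumes "openin (baire_topology X) U" "p \<in> U"
  obtains Z where "Z \<in> zero_sets X" "p \<in> Z" "Z \<subseteq> U"
  using assms by (auto simp: openin_baire_topology arbitrary_union_of_alt)

lemma Hausdorff_space_baire:
  assumes "tychonoff_space X"
  shows "Hausdorff_space (baire_topology X)"
  unfolding Hausdorff_space_def topspace_baire_topology
proof (intro allI impI)
  fix p q assume pq: "p \<in> topspace X \<and> q \<in> topspace X \<and> p \<noteq> q"
  then have "openin X (topspace X - {q})" "p \<in> topspace X - {q}"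
    using assms by (auto simp: tychonoff_space_def t1_space_closedin_singleton)
  then obtain f where "continuous_map X euclideanreal f" "f p = 0"
    "f ` (topspace X - (topspace X - {q})) \<subseteq> {1}"
    using assms unfolding tychonoff_space_def completely_regular_space_alt' by meson
  then have f: "continuous_map X euclideanreal f" "f p = 0" "f q = 1"
    using pq by auto
  let ?Z = "\<lambda>c. {x \<in> topspace X. f x = c}"
  have "openin (baire_topology X) (?Z c)" for c
    by (intro openin_baire_zero_set zero_sets_level_set f)
  moreover have "p \<in> ?Z 0" "q \<in> ?Z 1" "disjnt (?Z 0) (?Z 1)"
    using pq f by (auto simp: disjnt_iff)
  ultimately show "\<exists>U V. openin (baire_topology X) U \<and> openin (baire_topology X) V \<and>
      p \<in> U \<and> q \<in> V \<and> disjnt U V"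
    by blast
qed

text \<open>
  The zero-sets around the points of \<open>P\<close> may overlap, so the sum of their characteristic functions
  is only known to be at least \<open>1\<close> on \<open>P\<close>.
\<close>

lemma zero_set_combination_urysohn:
  assumes "finite P" "P \<subseteq> U" "openin (baire_topology X) U"
  shows "\<exists>f\<in>zero_set_combinations X. (\<forall>p\<in>P. 1 \<le> f p) \<and> (\<forall>y\<in>topspace X - U. f y \<le> 0)"
proof -
  obtain h k where P: "P = h ` {..<k::nat}"
    using assms(1) by (metis finite_imp_nat_seg_image_inj_on lessThan_def)
  have "\<forall>i. \<exists>Z. i < k \<longrightarrow> Z \<in> zero_sets X \<and> h i \<in> Z \<and> Z \<subseteq> U"
    using openin_baire_contains_zero_set[OF assms(3)] assms(2) P
    by (metis image_subset_iff lessThan_iff)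
  then obtain Z where Z: "\<And>i. i < k \<Longrightarrow> Z i \<in> zero_sets X \<and> h i \<in> Z i \<and> Z i \<subseteq> U"
    by metis
  define f where "f = (\<lambda>x\<in>topspace X. \<Sum>i<k. real 1 * indicator (Z i) x)"
  have "f \<in> zero_set_combinations X"
    unfolding zero_set_combinations_def f_def using Z
    by (intro CollectI exI[of _ k] exI[of _ "\<lambda>_. 1"] exI[of _ Z]) auto
  moreover have "1 \<le> f (h i)" if i: "i < k" for i
  proof -
    have "h i \<in> topspace X"
      using Z[OF i] openin_subset[OF assms(3)] by auto
    moreover have "indicator (Z i) (h i) \<le> (\<Sum>j<k. indicator (Z j) (h i) :: real)"
      by (rule member_le_sum) (use i in auto)
    ultimately show ?thesis
      using Z[OF i] by (simp add: f_def)
  qed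
  moreover have "f y \<le> 0" if "y \<in> topspace X - U" for y
  proof -
    have "(\<Sum>i<k. indicator (Z i) y :: real) = 0"
      by (rule sum.neutral) (use Z that in \<open>auto simp: indicator_def\<close>)
    then show ?thesis
      using that by (simp add: f_def)
  qed
  ultimately show ?thesis
    unfolding P by blast
qed

theorem theorem10p2:
  fixes X :: "'a topology" and E :: "('a \<Rightarrow> real) set"
  assumes "tychonoff_space X"
    and "zero_set_combinations X \<subseteq> E"
    and "E \<subseteq> continuous_functions (baire_topology X)"
  shows "tightness_star (baire_topology X) \<le>o lindelof_number (pointwise_topology X E)"
proof -
  let ?Y = "baire_topology X" and ?\<kappa> = "lindelof_number (pointwise_topology X E)"
  have "pointwise_topology ?Y E = pointwise_topology X E"
    by (simp add: pointwise_topology_def)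
  then have "lindelof_upto (pointwise_topology ?Y E) ?\<kappa>"
    by (simp add: lindelof_upto_lindelof_number)
  moreover have "\<exists>f\<in>E. (\<forall>p\<in>P. 1 \<le> f p) \<and> (\<forall>y\<in>topspace ?Y - U. f y \<le> 0)"
    if "finite P" "P \<subseteq> U" "openin ?Y U" for P U
    using zero_set_combination_urysohn[OF that] assms(2) by auto
  ultimately have "tightness_upto (power_topology ?Y n) ?\<kappa>" for n
    by (intro tightness_power_if_lindelof[OF Hausdorff_space_baire[OF assms(1)] assms(3)])
  then have "tightness (power_topology ?Y n) \<le>o ?\<kappa>" for n
    by (simp add: tightness_le_iff[OF Cinfinite_lindelof_number])
  moreover have "Card_order ?\<kappa>"
    using Cinfinite_lindelof_number by blast
  ultimately show ?thesis
    by (simp add: tightness_star_le_iff)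
qed

end
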